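(* Let $d=1$, $t_0<t_1$, $x_0,x_1\in\mathbb{R}$, $\eta>0$, $\rho>0$, and let $m_t,\tau_t,a_t$ and the probability density $J_t$ be as defined in the context. Let $\mu^J$ and $(\sigma^J)^2$ denote the mean and variance of $J_t$. For $t\neq\frac{t_0+t_1}{2}$ set $z_\pm:=-a_t\pm\sqrt{a_t^2+1}$ and $$I_0:=\sqrt{\pi/2}\,\Big(\mathrm{erf}\Big(\frac{z_+}{\sqrt2}\Big)-\mathrm{erf}\Big(\frac{z_-}{\sqrt2}\Big)\Big),\qquad I_1:=e^{-z_-^2/2}-e^{-z_+^2/2},$$ $$I_k:=(k-1)I_{k-2}-\big(z_+^{k-1}e^{-z_+^2/2}-z_-^{k-1}e^{-z_-^2/2}\big),\qquad k=2,3,4.$$ Then for $t\in\big(\frac{t_0+t_1}{2},t_1\big]$ it holds that $$\mu^J=m_t+\sqrt{\tau_t}\,\frac{I_3+2a_tI_2-I_1}{I_2+2a_tI_1-I_0},\qquad(\sigma^J)^2=\tau_t\,\frac{I_4+2a_tI_3-I_2}{I_2+2a_tI_1-I_0}-(m_t-\mu^J)^2.$$ For $t\in\big[t_0,\frac{t_0+t_1}{2}\big)$ the same two formulas hold if each $I_k$ ($k=0,\dots,4$) is replaced by $$\tilde I_k:=\frac{(-1)^k+1}{2}\sqrt{2\pi}\,(k-1)!!-I_k.$$ (For $t=\frac{t_0+t_1}{2}$ and $x_0=x_1$, $\mu^J=0$ and $\sigma^J=1$ by definition of $J_t$.)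
   Context: For $t\in[t_0,t_1]$ set $m_t:=\frac{t_1-t}{t_1-t_0}x_0+\frac{t-t_0}{t_1-t_0}x_1$ and $\tau_t:=\eta^2\frac{(t-t_0)(t_1-t)}{t_1-t_0}+\rho^2$; let $p_t$ be the density of $\mathcal N(m_t,\tau_t)$ on $\mathbb{R}$. With $d=1$, $$\xi_t(y):=\frac{\eta^2(t_0+t_1-2t)}{2(t_1-t_0)\tau_t}\Big(\frac{(y-m_t)^2}{\tau_t}+2a_t\frac{y-m_t}{\sqrt{\tau_t}}-1\Big),\qquad a_t:=\frac{\sqrt{\tau_t}}{\eta^2(t_0+t_1-2t)}(x_1-x_0)$$ (at $t=\frac{t_0+t_1}{2}$ the singularity of $a_t$ is cancelled by the prefactor). The density $J_t$ is $$J_t:=\frac{\max(0,\xi_t)\,p_t}{\int_{\mathbb{R}}\max(0,\xi_t)\,p_t\,\mathrm dy},$$ except that for $t=\frac{t_0+t_1}{2}$ and $x_0=x_1$ (where $\xi_t\equiv0$) $J_t$ is set to be the density of $\mathcal N(0,1)$. Conventions: $\mathrm{erf}(z)=\frac{2}{\sqrt\pi}\int_0^ze^{-s^2}\,\mathrm ds$; $n!!$ is the double factorial, with $(-1)!!=1$, and for odd $k$ the term $\frac{(-1)^k+1}{2}\sqrt{2\pi}(k-1)!!$ is $0$. *)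

theory Defs
  imports "HOL-Probability.Probability" "HOL-Computational_Algebra.Polynomial"
begin

text \<open>The interval integral is oriented, so negative arguments are covered.\<close>

definition erf :: "real \<Rightarrow> real" where
  "erf z = 2 / sqrt pi * (LBINT s=0..z. exp (- s\<^sup>2))"

text \<open>Integer arguments, so that \<open>(-1)!!\<close> is available; arguments below \<open>-1\<close> get the dummy value 1.\<close>

function dfact :: "int \<Rightarrow> nat" where
  "dfact n = (if n \<le> 0 then 1 else nat n * dfact (n - 2))"
  by auto
termination by (relation "Wellfounded.measure nat") auto

declare dfact.simps [simp del]

definition bridge_mean :: "real \<Rightarrow> real \<Rightarrow> real \<Rightarrow> real \<Rightarrow> real \<Rightarrow> real" where
  "bridge_mean t0 t1 x0 x1 t = (t1 - t) / (t1 - t0) * x0 + (t - t0) / (t1 - t0) * x1"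

definition bridge_var :: "real \<Rightarrow> real \<Rightarrow> real \<Rightarrow> real \<Rightarrow> real \<Rightarrow> real" where
  "bridge_var t0 t1 \<eta> \<rho> t = \<eta>\<^sup>2 * ((t - t0) * (t1 - t) / (t1 - t0)) + \<rho>\<^sup>2"

text \<open>The library's \<open>normal_density\<close> takes the standard deviation, not the variance.\<close>

definition bridge_density ::
  "real \<Rightarrow> real \<Rightarrow> real \<Rightarrow> real \<Rightarrow> real \<Rightarrow> real \<Rightarrow> real \<Rightarrow> real \<Rightarrow> real" where
  "bridge_density t0 t1 x0 x1 \<eta> \<rho> t =
     normal_density (bridge_mean t0 t1 x0 x1 t) (sqrt (bridge_var t0 t1 \<eta> \<rho> t))"

text \<open>Meaningful only for \<open>t \<noteq> (t0 + t1) / 2\<close>; at the midpoint HOL's division by zero makes it 0.\<close>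

definition a_coeff :: "real \<Rightarrow> real \<Rightarrow> real \<Rightarrow> real \<Rightarrow> real \<Rightarrow> real \<Rightarrow> real \<Rightarrow> real" where
  "a_coeff t0 t1 x0 x1 \<eta> \<rho> t =
     sqrt (bridge_var t0 t1 \<eta> \<rho> t) / (\<eta>\<^sup>2 * (t0 + t1 - 2 * t)) * (x1 - x0)"

text \<open>The first branch is what the general expression becomes at the midpoint, where the factor
  \<open>t0 + t1 - 2 * t\<close> in front cancels against the one in the denominator of \<open>a_coeff\<close>.\<close>

definition xi ::
  "real \<Rightarrow> real \<Rightarrow> real \<Rightarrow> real \<Rightarrow> real \<Rightarrow> real \<Rightarrow> real \<Rightarrow> real \<Rightarrow> real" where
  "xi t0 t1 x0 x1 \<eta> \<rho> t y =
     (let m = bridge_mean t0 t1 x0 x1 t; \<tau> = bridge_var t0 t1 \<eta> \<rho> t in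
      if t = (t0 + t1) / 2 then (x1 - x0) * (y - m) / ((t1 - t0) * \<tau>)
      else \<eta>\<^sup>2 * (t0 + t1 - 2 * t) / (2 * (t1 - t0) * \<tau>) *
             ((y - m)\<^sup>2 / \<tau> + 2 * a_coeff t0 t1 x0 x1 \<eta> \<rho> t * ((y - m) / sqrt \<tau>) - 1))"

definition J_density ::
  "real \<Rightarrow> real \<Rightarrow> real \<Rightarrow> real \<Rightarrow> real \<Rightarrow> real \<Rightarrow> real \<Rightarrow> real \<Rightarrow> real" where
  "J_density t0 t1 x0 x1 \<eta> \<rho> t y =
     (if t = (t0 + t1) / 2 \<and> x0 = x1 then std_normal_density y
      else max 0 (xi t0 t1 x0 x1 \<eta> \<rho> t y) * bridge_density t0 t1 x0 x1 \<eta> \<rho> t y /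
           (LINT u|lborel. max 0 (xi t0 t1 x0 x1 \<eta> \<rho> t u) * bridge_density t0 t1 x0 x1 \<eta> \<rho> t u))"

definition J_law ::
  "real \<Rightarrow> real \<Rightarrow> real \<Rightarrow> real \<Rightarrow> real \<Rightarrow> real \<Rightarrow> real \<Rightarrow> real measure" where
  "J_law t0 t1 x0 x1 \<eta> \<rho> t = density lborel (\<lambda>y. ennreal (J_density t0 t1 x0 x1 \<eta> \<rho> t y))"

definition J_mean :: "real \<Rightarrow> real \<Rightarrow> real \<Rightarrow> real \<Rightarrow> real \<Rightarrow> real \<Rightarrow> real \<Rightarrow> real" where
  "J_mean t0 t1 x0 x1 \<eta> \<rho> t = prob_space.expectation (J_law t0 t1 x0 x1 \<eta> \<rho> t) (\<lambda>y. y)"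

definition J_sd :: "real \<Rightarrow> real \<Rightarrow> real \<Rightarrow> real \<Rightarrow> real \<Rightarrow> real \<Rightarrow> real \<Rightarrow> real" where
  "J_sd t0 t1 x0 x1 \<eta> \<rho> t = sqrt (prob_space.variance (J_law t0 t1 x0 x1 \<eta> \<rho> t) (\<lambda>y. y))"

definition z_plus :: "real \<Rightarrow> real" where
  "z_plus a = - a + sqrt (a\<^sup>2 + 1)"

definition z_minus :: "real \<Rightarrow> real" where
  "z_minus a = - a - sqrt (a\<^sup>2 + 1)"

text \<open>The last equation is the recursion for index \<open>k + 2\<close>.\<close>

fun I_seq :: "real \<Rightarrow> nat \<Rightarrow> real" where
  "I_seq a 0 = sqrt (pi / 2) * (erf (z_plus a / sqrt 2) - erf (z_minus a / sqrt 2))"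
| "I_seq a (Suc 0) = exp (- (z_minus a)\<^sup>2 / 2) - exp (- (z_plus a)\<^sup>2 / 2)"
| "I_seq a (Suc (Suc k)) = real (k + 1) * I_seq a k
     - (z_plus a ^ (k + 1) * exp (- (z_plus a)\<^sup>2 / 2)
        - z_minus a ^ (k + 1) * exp (- (z_minus a)\<^sup>2 / 2))"

definition I_tilde :: "real \<Rightarrow> nat \<Rightarrow> real" where
  "I_tilde a k = ((-1) ^ k + 1) / 2 * sqrt (2 * pi) * real (dfact (int k - 1)) - I_seq a k"

text \<open>The law is a probability measure with finite first and second moments, so the normalising
  constant, the mean and the variance are never default values of the Bochner integral.\<close>

lemma bridge_var_pos:
  assumes "t0 < t1" "\<rho> > 0" "t \<in> {t0..t1}"
  shows "bridge_var t0 t1 \<eta> \<rho> t > 0"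
  unfolding bridge_var_def using assms by (intro add_nonneg_pos) auto

lemma xi_as_poly:
  "\<exists>q. \<forall>y. xi t0 t1 x0 x1 \<eta> \<rho> t y = poly q (y - bridge_mean t0 t1 x0 x1 t)"
proof (cases "t = (t0 + t1) / 2")
  case True
  show ?thesis
    by (rule exI[of _ "[:0, (x1 - x0) / ((t1 - t0) * bridge_var t0 t1 \<eta> \<rho> t):]"])
       (simp add: xi_def True)
next
  case False
  define v where "v = bridge_var t0 t1 \<eta> \<rho> t"
  define c where "c = \<eta>\<^sup>2 * (t0 + t1 - 2 * t) / (2 * (t1 - t0) * v)"
  define a where "a = a_coeff t0 t1 x0 x1 \<eta> \<rho> t"
  have "c * (u\<^sup>2 / v + 2 * a * (u / sqrt v) - 1) = poly (smult c [:- 1, 2 * a / sqrt v, 1 / v:]) u" for u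
    by (simp add: power2_eq_square algebra_simps)
  then show ?thesis
    unfolding xi_def Let_def v_def[symmetric] a_def[symmetric] c_def[symmetric] if_not_P[OF False]
    by metis
qed

lemma continuous_on_xi: "continuous_on UNIV (xi t0 t1 x0 x1 \<eta> \<rho> t)"
proof -
  obtain q where q: "xi t0 t1 x0 x1 \<eta> \<rho> t = (\<lambda>y. poly q (y - bridge_mean t0 t1 x0 x1 t))"
    using xi_as_poly by blast
  show ?thesis unfolding q by (intro continuous_intros)
qed

lemma borel_measurable_xi [measurable]: "xi t0 t1 x0 x1 \<eta> \<rho> t \<in> borel_measurable borel"
  by (rule borel_measurable_continuous_onI[OF continuous_on_xi])

lemma xi_pos_somewhere:
  assumes "t0 < t1" "\<eta> > 0" "\<rho> > 0" "t \<in> {t0..t1}" "\<not> (t = (t0 + t1) / 2 \<and> x0 = x1)"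
  shows "\<exists>y. xi t0 t1 x0 x1 \<eta> \<rho> t y > 0"
proof -
  define m where "m = bridge_mean t0 t1 x0 x1 t"
  define v where "v = bridge_var t0 t1 \<eta> \<rho> t"
  define a where "a = a_coeff t0 t1 x0 x1 \<eta> \<rho> t"
  have v: "v > 0" using bridge_var_pos assms unfolding v_def by blast
  consider "t = (t0 + t1) / 2" "x0 \<noteq> x1" | "t > (t0 + t1) / 2" | "t < (t0 + t1) / 2"
    using assms by linarith
  then show ?thesis
  proof cases
    case 1
    have "0 < (x1 - x0) * (x1 - x0)" using 1 by (simp add: zero_less_mult_iff) linarith
    then have "xi t0 t1 x0 x1 \<eta> \<rho> t (m + (x1 - x0)) > 0"
      using 1 assms v by (simp add: xi_def m_def[symmetric] v_def[symmetric])
    then show ?thesis ..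
  next
    case 2
    have "\<eta>\<^sup>2 * (t0 + t1 - 2 * t) / (2 * (t1 - t0) * v) < 0"
      using 2 assms v by (intro divide_neg_pos mult_pos_neg mult_pos_pos) auto
    then have "xi t0 t1 x0 x1 \<eta> \<rho> t m > 0"
      using 2 by (auto simp add: xi_def m_def[symmetric] v_def[symmetric] Let_def)
    then show ?thesis ..
  next
    case 3
    define z where "z = 2 + 2 * \<bar>a\<bar>"
    have c: "\<eta>\<^sup>2 * (t0 + t1 - 2 * t) / (2 * (t1 - t0) * v) > 0"
      using 3 assms v by (intro divide_pos_pos mult_pos_pos) auto
    have "2 * 2 \<le> z * (z + 2 * a)"
      unfolding z_def by (intro mult_mono) auto
    then have z: "z\<^sup>2 + 2 * a * z - 1 > 0" by (simp add: power2_eq_square algebra_simps)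
    have "xi t0 t1 x0 x1 \<eta> \<rho> t (m + sqrt v * z) =
        \<eta>\<^sup>2 * (t0 + t1 - 2 * t) / (2 * (t1 - t0) * v) * (z\<^sup>2 + 2 * a * z - 1)"
      using 3 v by (auto simp: xi_def m_def[symmetric] v_def[symmetric] a_def[symmetric] Let_def power_mult_distrib)
    then show ?thesis using mult_pos_pos[OF c z] by metis
  qed
qed

lemma integrable_poly_normal:
  assumes "s > 0"
  shows "integrable lborel (\<lambda>y. poly q (y - m) * normal_density m s y)"
proof -
  have "integrable lborel (\<lambda>y. \<Sum>i\<le>degree q. coeff q i * (normal_density m s y * (y - m) ^ i))"
    using assms by (intro Bochner_Integration.integrable_sum integrable_mult_right integrable_normal_moment)
  then show ?thesis by (simp add: poly_altdef sum_distrib_left sum_distrib_right mult_ac)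
qed

lemma integrable_xi_moment:
  assumes "t0 < t1" "\<rho> > 0" "t \<in> {t0..t1}"
  shows "integrable lborel
    (\<lambda>y. y ^ k * (max 0 (xi t0 t1 x0 x1 \<eta> \<rho> t y) * bridge_density t0 t1 x0 x1 \<eta> \<rho> t y))"
proof -
  define m where "m = bridge_mean t0 t1 x0 x1 t"
  define s where "s = sqrt (bridge_var t0 t1 \<eta> \<rho> t)"
  have s: "s > 0" using bridge_var_pos[OF assms] by (simp add: s_def)
  obtain q where q: "\<And>y. xi t0 t1 x0 x1 \<eta> \<rho> t y = poly q (y - m)"
    using xi_as_poly unfolding m_def by blast
  have "integrable lborel (\<lambda>y. poly ([:m, 1:] ^ k * q) (y - m) * normal_density m s y)"
    by (rule integrable_poly_normal[OF s])
  then have "integrable lborel (\<lambda>y. y ^ k * xi t0 t1 x0 x1 \<eta> \<rho> t y * normal_density m s y)"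
    by (simp add: q)
  then show ?thesis
    unfolding bridge_density_def m_def[symmetric] s_def[symmetric]
    by (rule Bochner_Integration.integrable_bound)
       (auto simp: abs_mult mult.assoc intro!: mult_left_mono mult_right_mono)
qed

lemma normaliser_pos:
  assumes "t0 < t1" "\<eta> > 0" "\<rho> > 0" "t \<in> {t0..t1}" "\<not> (t = (t0 + t1) / 2 \<and> x0 = x1)"
  shows "(LINT u|lborel. max 0 (xi t0 t1 x0 x1 \<eta> \<rho> t u) * bridge_density t0 t1 x0 x1 \<eta> \<rho> t u) > 0"
    (is "integral\<^sup>L lborel ?f > 0")
proof -
  let ?S = "{y. 0 < xi t0 t1 x0 x1 \<eta> \<rho> t y}"
  have int: "integrable lborel ?f"
    using integrable_xi_moment[OF assms(1,3,4), of 0] by simp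
  have pos: "bridge_density t0 t1 x0 x1 \<eta> \<rho> t y > 0" for y
    unfolding bridge_density_def using bridge_var_pos assms by (intro normal_density_pos) auto
  have nn: "?f y \<ge> 0" for y using pos[of y] by simp
  have "integral\<^sup>L lborel ?f \<noteq> 0"
  proof
    assume "integral\<^sup>L lborel ?f = 0"
    then have "AE y in lborel. ?f y = 0"
      using integral_nonneg_eq_0_iff_AE[OF int] nn by simp
    then have "AE y in lborel. y \<notin> ?S"
      by eventually_elim (use pos in \<open>auto simp: max_def split: if_splits, metis less_irrefl\<close>)
    moreover have "?S \<in> sets lborel" by measurable
    ultimately have "?S \<in> null_sets lborel"
      by (simp add: AE_iff_null_sets)
    then have "negligible ?S"
      by (simp add: negligible_iff_null_sets null_sets_completionI)
    moreover have "open ?S"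
      by (rule open_Collect_less[OF continuous_on_const continuous_on_xi])
    moreover have "?S \<noteq> {}" using xi_pos_somewhere[OF assms] by auto
    ultimately show False using open_not_negligible by blast
  qed
  moreover have "integral\<^sup>L lborel ?f \<ge> 0" using nn by simp
  ultimately show ?thesis by linarith
qed

lemma J_density_measurable [measurable]: "J_density t0 t1 x0 x1 \<eta> \<rho> t \<in> borel_measurable borel"
  unfolding J_density_def bridge_density_def by measurable

lemma J_density_nonneg:
  "J_density t0 t1 x0 x1 \<eta> \<rho> t y \<ge> 0"
  unfolding J_density_def bridge_density_def
  by (auto intro!: divide_nonneg_nonneg integral_nonneg_AE mult_nonneg_nonneg)

lemma integrable_J_density:
  assumes "t0 < t1" "\<rho> > 0" "t \<in> {t0..t1}"
  shows "integrable lborel (\<lambda>y. y ^ k * J_density t0 t1 x0 x1 \<eta> \<rho> t y)"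
proof (cases "t = (t0 + t1) / 2 \<and> x0 = x1")
  case True
  then show ?thesis
    using integrable_normal_moment[of 1 0 k] by (simp add: J_density_def mult.commute)
next
  case False
  show ?thesis
    unfolding J_density_def if_not_P[OF False] times_divide_eq_right
    by (rule integrable_divide[OF integrable_xi_moment[OF assms]])
qed

lemma prob_space_J_law:
  assumes "t0 < t1" "\<eta> > 0" "\<rho> > 0" "t \<in> {t0..t1}"
  shows "prob_space (J_law t0 t1 x0 x1 \<eta> \<rho> t)"
proof -
  have "(LINT y|lborel. J_density t0 t1 x0 x1 \<eta> \<rho> t y) = 1"
    using normaliser_pos[OF assms, of x0 x1] by (cases "t = (t0 + t1) / 2 \<and> x0 = x1") (auto simp: J_density_def)
  then have "(\<integral>\<^sup>+ y. ennreal (J_density t0 t1 x0 x1 \<eta> \<rho> t y) \<partial>lborel) = 1"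
    using nn_integral_eq_integral[of lborel "J_density t0 t1 x0 x1 \<eta> \<rho> t"]
      integrable_J_density[OF assms(1,3,4), of 0] J_density_nonneg by simp
  then show ?thesis
    by (intro prob_spaceI) (simp add: J_law_def emeasure_density)
qed

lemma integrable_J_law:
  assumes "t0 < t1" "\<rho> > 0" "t \<in> {t0..t1}"
  shows "integrable (J_law t0 t1 x0 x1 \<eta> \<rho> t) (\<lambda>y. y ^ k)"
  unfolding J_law_def using integrable_J_density[OF assms, of k]
  by (subst integrable_real_density) (auto simp: J_density_nonneg mult.commute)

end

theory Submission
  imports Defs
begin

text \<open>
  In the standardised variable \<open>u = (y - m) / sqrt \<tau>\<close> the function \<open>xi\<close> is a constant \<open>c\<close> times the quadratic
  \<open>u\<^sup>2 + 2 a u - 1\<close>, whose roots are \<open>z_minus a\<close> and \<open>z_plus a\<close>, and \<open>c\<close> has the sign of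
  \<open>t0 + t1 - 2 t\<close>. Hence the positive part of \<open>xi\<close> is \<open>xi\<close> itself restricted to a fixed set \<open>S\<close>: the
  interval between the roots in the second half of the bridge, its complement in the first half.
  So the \<open>k\<close>-th standardised moment of the law is the quotient
  \<open>(M (k+2) + 2 a M (k+1) - M k) / (M 2 + 2 a M 1 - M 0)\<close>, where \<open>M k\<close> is the integral of
  \<open>u ^ k * exp (- u\<^sup>2 / 2)\<close> over \<open>S\<close>; the constant \<open>c\<close> and the Gaussian normalisation cancel
  (\<open>J_law_standardised_moment\<close>). Mean and variance are read off from \<open>k = 1\<close> and \<open>k = 2\<close>.

  It remains to recognise \<open>M k\<close>. Over the interval, integration by parts gives exactly the recursion
  that defines \<open>I_seq\<close>, with the error function as its initial value (\<open>gauss_moment_between_roots\<close>).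
  Over the complement, it is the full Gaussian moment, a double factorial for even \<open>k\<close>, minus the
  moment over the interval, which is \<open>I_tilde\<close> (\<open>gauss_moment_outside_roots\<close>).
\<close>

section \<open>Gaussian moments over a set\<close>

definition gauss_moment :: "real set \<Rightarrow> nat \<Rightarrow> real" where
  "gauss_moment S k = (LINT z|lborel. indicator S z * (z ^ k * exp (- z\<^sup>2 / 2)))"

lemma pow_exp_eq_std_normal:
  "z ^ k * exp (- z\<^sup>2 / 2) = sqrt (2 * pi) * (std_normal_density z * z ^ k)"
  by (simp add: std_normal_density_def)

lemma integrable_gauss_moment:
  assumes "S \<in> sets borel"
  shows "integrable lborel (\<lambda>z::real. indicator S z * (z ^ k * exp (- z\<^sup>2 / 2)))"
proof -
  have "integrable lborel (\<lambda>z::real. z ^ k * exp (- z\<^sup>2 / 2))"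
    unfolding pow_exp_eq_std_normal
    using integrable_normal_moment[of 1 0 k] by (intro integrable_mult_right) simp
  from integrable_mult_indicator[OF _ this, of S] assms show ?thesis by simp
qed

lemma gauss_moment_Compl:
  assumes "S \<in> sets borel"
  shows "gauss_moment (- S) k = gauss_moment UNIV k - gauss_moment S k"
proof -
  have "gauss_moment UNIV k - gauss_moment S k =
      (LINT z|lborel. indicator UNIV z * (z ^ k * exp (- z\<^sup>2 / 2))
         - indicator S z * (z ^ k * exp (- z\<^sup>2 / 2)))"
    unfolding gauss_moment_def
    by (rule Bochner_Integration.integral_diff[symmetric]) (intro integrable_gauss_moment; use assms in simp)+
  also have "\<dots> = gauss_moment (- S) k"
    unfolding gauss_moment_def by (rule Bochner_Integration.integral_cong) (auto simp: indicator_def)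
  finally show ?thesis ..
qed

text \<open>Translates the factorial form of the even moments of the standard normal law.\<close>

lemma dfact_odd_eq: "real (dfact (2 * int n - 1)) = fact (2 * n) / (2 ^ n * fact n)"
proof (induction n)
  case 0
  then show ?case by (simp add: dfact.simps)
next
  case (Suc n)
  have "dfact (2 * int (Suc n) - 1) = (2 * n + 1) * dfact (2 * int n - 1)"
    by (subst dfact.simps) (simp add: nat_add_distrib nat_mult_distrib)
  then show ?case
    by (simp add: Suc.IH divide_simps) (simp add: algebra_simps)
qed

lemma gauss_moment_UNIV:
  "gauss_moment UNIV k = ((-1) ^ k + 1) / 2 * sqrt (2 * pi) * real (dfact (int k - 1))"
proof (cases "even k")
  case True
  then obtain n where n: "k = 2 * n" by (elim evenE)
  show ?thesis
    unfolding gauss_moment_def pow_exp_eq_std_normal n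
    using integral_std_normal_moment_even[of n] dfact_odd_eq[of n] by simp
next
  case False
  then obtain n where n: "k = 2 * n + 1" by (elim oddE)
  show ?thesis
    unfolding gauss_moment_def pow_exp_eq_std_normal n
    using integral_std_normal_moment_odd[of n] by simp
qed

lemma erf_deriv: "(erf has_real_derivative 2 / sqrt pi * exp (- x\<^sup>2)) (at x)"
proof -
  \<comment> \<open>a window with both the base point 0 and the point \<open>x\<close> inside, whatever the sign of \<open>x\<close>\<close>
  define b where "b = \<bar>x\<bar> + 1"
  have "((\<lambda>u. LBINT s=0..u. exp (- s\<^sup>2)) has_vector_derivative exp (- x\<^sup>2)) (at x within {- b..b})"
    unfolding zero_ereal_def by (rule interval_integral_FTC2) (auto simp: b_def intro!: continuous_intros)
  moreover have "at x within {- b..b} = at x"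
    by (rule at_within_interior) (auto simp: b_def)
  ultimately have "((\<lambda>u. LBINT s=0..u. exp (- s\<^sup>2)) has_real_derivative exp (- x\<^sup>2)) (at x)"
    by (simp add: has_real_derivative_iff_has_vector_derivative)
  from DERIV_cmult[OF this, of "2 / sqrt pi"] show ?thesis
    by (simp add: erf_def[abs_def])
qed

lemma gauss_moment_Icc_FTC:
  assumes "p \<le> q"
    and "\<And>x. (F has_real_derivative x ^ k * exp (- x\<^sup>2 / 2)) (at x)"
  shows "gauss_moment {p..q} k = F q - F p"
proof -
  have "(LINT x|lborel. indicator {p..q} x *\<^sub>R (x ^ k * exp (- x\<^sup>2 / 2))) = F q - F p"
    using assms
    by (intro integral_FTC_atLeastAtMost)
       (auto simp: has_real_derivative_iff_has_vector_derivative[symmetric]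
             intro: has_field_derivative_at_within intro!: continuous_intros)
  then show ?thesis by (simp add: gauss_moment_def)
qed

lemma gauss_moment_Icc_0:
  assumes "p \<le> q"
  shows "gauss_moment {p..q} 0 = sqrt (pi / 2) * (erf (q / sqrt 2) - erf (p / sqrt 2))"
proof -
  have "((\<lambda>x. sqrt (pi / 2) * erf (x / sqrt 2)) has_real_derivative x ^ 0 * exp (- x\<^sup>2 / 2)) (at x)" for x
    by (rule derivative_eq_intros DERIV_chain2[OF erf_deriv] refl | simp)+
       (simp add: power_divide real_sqrt_divide)
  from gauss_moment_Icc_FTC[OF assms this] show ?thesis by (simp add: algebra_simps)
qed

lemma gauss_moment_Icc_1:
  assumes "p \<le> q"
  shows "gauss_moment {p..q} 1 = exp (- p\<^sup>2 / 2) - exp (- q\<^sup>2 / 2)"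
proof -
  have "((\<lambda>x. - exp (- x\<^sup>2 / 2)) has_real_derivative x ^ 1 * exp (- x\<^sup>2 / 2)) (at x)" for x :: real
    by (rule derivative_eq_intros refl | simp)+
  from gauss_moment_Icc_FTC[OF assms this] show ?thesis by simp
qed

text \<open>Integration by parts, since \<open>x * exp (- x\<^sup>2 / 2)\<close> is the derivative of \<open>- exp (- x\<^sup>2 / 2)\<close>.\<close>

lemma gauss_moment_Icc_rec:
  assumes "p \<le> q"
  shows "gauss_moment {p..q} (k + 2) = real (k + 1) * gauss_moment {p..q} k
    - (q ^ (k + 1) * exp (- q\<^sup>2 / 2) - p ^ (k + 1) * exp (- p\<^sup>2 / 2))"
proof -
  let ?F = "\<lambda>x::real. - (x ^ (k + 1) * exp (- x\<^sup>2 / 2))"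
  let ?f = "\<lambda>j x::real. x ^ j * exp (- x\<^sup>2 / 2)"
  have "(?F has_real_derivative ?f (k + 2) x - real (k + 1) * ?f k x) (at x)" for x
    by (rule derivative_eq_intros refl | simp add: algebra_simps)+
  then have "(LINT x|lborel. indicator {p..q} x *\<^sub>R (?f (k + 2) x - real (k + 1) * ?f k x)) = ?F q - ?F p"
    using assms
    by (intro integral_FTC_atLeastAtMost)
       (auto simp: has_real_derivative_iff_has_vector_derivative[symmetric]
             intro: has_field_derivative_at_within intro!: continuous_intros)
  moreover have "(LINT x|lborel. indicator {p..q} x *\<^sub>R (?f (k + 2) x - real (k + 1) * ?f k x)) =
      (LINT x|lborel. indicator {p..q} x * ?f (k + 2) x - real (k + 1) * (indicator {p..q} x * ?f k x))"
    by (rule Bochner_Integration.integral_cong) (simp_all add: algebra_simps)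
  moreover have "\<dots> = gauss_moment {p..q} (k + 2) - real (k + 1) * gauss_moment {p..q} k"
    unfolding gauss_moment_def integral_mult_right_zero[symmetric]
    by (intro Bochner_Integration.integral_diff integrable_mult_right integrable_gauss_moment) simp_all
  ultimately show ?thesis by linarith
qed

section \<open>The roots of the quadratic\<close>

lemma z_minus_le_z_plus: "z_minus a \<le> z_plus a"
proof -
  have "0 \<le> sqrt (a\<^sup>2 + 1)" by simp
  then show ?thesis unfolding z_minus_def z_plus_def by linarith
qed

lemma quadratic_factor: "z\<^sup>2 + 2 * a * z - 1 = (z - z_minus a) * (z - z_plus a)"
proof -
  define r where "r = sqrt (a\<^sup>2 + 1)"
  have "r * r = a\<^sup>2 + 1" unfolding r_def by simp
  then show ?thesis
    unfolding z_minus_def z_plus_def r_def[symmetric] by (simp add: power2_eq_square algebra_simps)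
qed

lemma quadratic_nonpos_iff: "z\<^sup>2 + 2 * a * z - 1 \<le> 0 \<longleftrightarrow> z \<in> {z_minus a..z_plus a}"
  unfolding quadratic_factor using z_minus_le_z_plus[of a] by (auto simp: mult_le_0_iff)

lemma gauss_moment_between_roots: "gauss_moment {z_minus a..z_plus a} k = I_seq a k"
proof (induction a k rule: I_seq.induct)
  case (1 a)
  then show ?case using gauss_moment_Icc_0[OF z_minus_le_z_plus] by simp
next
  case (2 a)
  then show ?case using gauss_moment_Icc_1[OF z_minus_le_z_plus] by simp
next
  case (3 a k)
  then show ?case using gauss_moment_Icc_rec[OF z_minus_le_z_plus, of a k] by simp
qed

lemma gauss_moment_outside_roots: "gauss_moment (- {z_minus a..z_plus a}) k = I_tilde a k"
  by (simp add: gauss_moment_Compl gauss_moment_UNIV gauss_moment_between_roots I_tilde_def)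

section \<open>Standardised moments of the law\<close>

text \<open>The Gaussian moment over \<open>S\<close> with the extra weight \<open>z\<^sup>2 + 2 a z - 1\<close>, expanded by linearity.\<close>

definition quad_moment :: "real set \<Rightarrow> real \<Rightarrow> nat \<Rightarrow> real" where
  "quad_moment S a k = gauss_moment S (k + 2) + 2 * a * gauss_moment S (k + 1) - gauss_moment S k"

text \<open>The affine substitution \<open>y = m + s z\<close> absorbs the factor \<open>1 / s\<close> of the normal density, so the
  prefactor depends neither on \<open>m\<close> nor on \<open>s\<close> nor on \<open>k\<close>, and it cancels in quotients of such integrals.\<close>

lemma normal_integral_pos_part_quadratic:
  assumes s: "s > 0" and S: "S \<in> sets borel"
    and pos: "\<And>z. max 0 (c * (z\<^sup>2 + 2 * a * z - 1)) = c * (z\<^sup>2 + 2 * a * z - 1) * indicator S z"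
  shows "(LINT y|lborel. ((y - m) / s) ^ k *
      (max 0 (c * (((y - m) / s)\<^sup>2 + 2 * a * ((y - m) / s) - 1)) * normal_density m s y))
    = c / sqrt (2 * pi) * quad_moment S a k" (is "integral\<^sup>L lborel ?f = _")
proof -
  let ?g = "\<lambda>j z. indicator S z * (z ^ j * exp (- z\<^sup>2 / 2)) :: real"
  have f: "s * ?f (m + s * z) = c / sqrt (2 * pi) * (?g (k + 2) z + 2 * a * ?g (k + 1) z - ?g k z)" for z
  proof -
    have u: "(m + s * z - m) / s = z" using s by simp
    have n: "s * normal_density m s (m + s * z) = exp (- z\<^sup>2 / 2) / sqrt (2 * pi)"
      using s by (simp add: normal_density_def real_sqrt_mult power_mult_distrib)
    have "s * ?f (m + s * z) =
        z ^ k * (c * (z\<^sup>2 + 2 * a * z - 1) * indicator S z) * (s * normal_density m s (m + s * z))"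
      unfolding u pos by (simp add: mult_ac)
    then show ?thesis
      unfolding n by (simp add: power_add power2_eq_square algebra_simps diff_divide_distrib add_divide_distrib)
  qed
  have "integral\<^sup>L lborel ?f = (LINT z|lborel. s * ?f (m + s * z))"
    using lborel_integral_real_affine[of s ?f m] s by simp
  also have "\<dots> = c / sqrt (2 * pi) * (LINT z|lborel. ?g (k + 2) z + 2 * a * ?g (k + 1) z - ?g k z)"
    unfolding f by (rule integral_mult_right_zero)
  also have "(LINT z|lborel. ?g (k + 2) z + 2 * a * ?g (k + 1) z - ?g k z) = quad_moment S a k"
  proof -
    note i = integrable_gauss_moment[OF S]
    have i': "integrable lborel (\<lambda>z. 2 * a * ?g (k + 1) z)"
      by (intro integrable_mult_right i)
    show ?thesis
      unfolding quad_moment_def gauss_moment_def integral_mult_right_zero[symmetric]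
        Bochner_Integration.integral_diff[OF Bochner_Integration.integrable_add[OF i i'] i]
        Bochner_Integration.integral_add[OF i i'] ..
  qed
  finally show ?thesis .
qed

text \<open>The positive part of \<open>xi\<close> is supported between the roots when its leading coefficient is negative,
  that is, after the midpoint, and outside the roots before it. At the roots \<open>xi\<close> vanishes,
  so the boundary points may go to either side and the two sets can be exact complements.\<close>

definition support_set :: "real \<Rightarrow> real \<Rightarrow> real \<Rightarrow> real \<Rightarrow> real set" where
  "support_set t0 t1 t a =
     (if t > (t0 + t1) / 2 then {z_minus a..z_plus a} else - {z_minus a..z_plus a})"

text \<open>Numerator and normalising constant of the density are the same integral for \<open>k\<close> and for \<open>0\<close>. Away
  from the midpoint the leading coefficient \<open>c\<close> of \<open>xi\<close> is nonzero, hence it cancels.\<close>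

lemma J_law_standardised_moment:
  fixes t0 t1 x0 x1 \<eta> \<rho> t :: real
  assumes t: "t0 < t1" "\<eta> > 0" "\<rho> > 0" "t \<in> {t0..t1}" "t \<noteq> (t0 + t1) / 2"
  defines "m \<equiv> bridge_mean t0 t1 x0 x1 t" and "s \<equiv> sqrt (bridge_var t0 t1 \<eta> \<rho> t)"
    and "a \<equiv> a_coeff t0 t1 x0 x1 \<eta> \<rho> t"
  defines "S \<equiv> support_set t0 t1 t a"
  shows "(LINT y|J_law t0 t1 x0 x1 \<eta> \<rho> t. ((y - m) / s) ^ k) = quad_moment S a k / quad_moment S a 0"
proof -
  define v where "v = bridge_var t0 t1 \<eta> \<rho> t"
  define c where "c = \<eta>\<^sup>2 * (t0 + t1 - 2 * t) / (2 * (t1 - t0) * v)"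
  have v: "v > 0" using bridge_var_pos t unfolding v_def by blast
  have s: "s > 0" and ss: "s\<^sup>2 = v" using v by (simp_all add: s_def v_def)
  have c0: "c \<noteq> 0" using t v by (auto simp: c_def)
  have S: "S \<in> sets borel" by (simp add: S_def support_set_def)
  have pos: "max 0 (c * (z\<^sup>2 + 2 * a * z - 1)) = c * (z\<^sup>2 + 2 * a * z - 1) * indicator S z" for z
  proof (cases "t > (t0 + t1) / 2")
    case True
    then have "c < 0" using t v unfolding c_def by (intro divide_neg_pos mult_pos_neg) auto
    then have "0 \<le> c * (z\<^sup>2 + 2 * a * z - 1) \<longleftrightarrow> z \<in> S"
      using True by (simp add: S_def support_set_def zero_le_mult_iff quadratic_nonpos_iff[simplified] not_less)
    then show ?thesis by (auto simp: max_def indicator_def)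
  next
    case False
    then have "c > 0" using t v unfolding c_def by (intro divide_pos_pos mult_pos_pos) auto
    then have "c * (z\<^sup>2 + 2 * a * z - 1) \<le> 0 \<longleftrightarrow> z \<notin> S"
      using False by (simp add: S_def support_set_def mult_le_0_iff quadratic_nonpos_iff[simplified] not_less)
    then show ?thesis by (auto simp: max_def indicator_def)
  qed
  have xi: "xi t0 t1 x0 x1 \<eta> \<rho> t y = c * (((y - m) / s)\<^sup>2 + 2 * a * ((y - m) / s) - 1)" for y
    using t(5) unfolding xi_def Let_def m_def a_def s_def c_def v_def
    using v by (simp add: power_divide v_def)
  define D where "D = (\<lambda>u. max 0 (xi t0 t1 x0 x1 \<eta> \<rho> t u) * bridge_density t0 t1 x0 x1 \<eta> \<rho> t u)"
  have D: "(LINT y|lborel. ((y - m) / s) ^ j * D y) = c / sqrt (2 * pi) * quad_moment S a j" for j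
    unfolding D_def xi bridge_density_def m_def[symmetric] s_def[symmetric]
    by (rule normal_integral_pos_part_quadratic[OF s S pos])
  have J: "J_density t0 t1 x0 x1 \<eta> \<rho> t y = D y / integral\<^sup>L lborel D" for y
    using t(5) by (simp add: J_density_def D_def)
  have "(LINT y|J_law t0 t1 x0 x1 \<eta> \<rho> t. ((y - m) / s) ^ k) =
      (LINT y|lborel. J_density t0 t1 x0 x1 \<eta> \<rho> t y *\<^sub>R ((y - m) / s) ^ k)"
    unfolding J_law_def by (rule integral_density) (auto simp: J_density_nonneg)
  also have "\<dots> = (LINT y|lborel. ((y - m) / s) ^ k * D y) / integral\<^sup>L lborel D"
    unfolding J integral_divide_zero[symmetric]
    by (rule Bochner_Integration.integral_cong) simp_all
  also have "integral\<^sup>L lborel D = c / sqrt (2 * pi) * quad_moment S a 0"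
    using D[of 0] by simp
  finally show ?thesis unfolding D using c0 by simp
qed

section \<open>Mean and variance\<close>

lemma J_sd_squared:
  assumes "t0 < t1" "\<eta> > 0" "\<rho> > 0" "t \<in> {t0..t1}"
  shows "(J_sd t0 t1 x0 x1 \<eta> \<rho> t)\<^sup>2 =
    (LINT y|J_law t0 t1 x0 x1 \<eta> \<rho> t. (y - J_mean t0 t1 x0 x1 \<eta> \<rho> t)\<^sup>2)"
  unfolding J_sd_def J_mean_def by (rule real_sqrt_pow2) simp

lemma mean_variance_of_standardised_moments:
  fixes m s :: real
  assumes "prob_space P" "s \<noteq> 0"
    and "\<And>k. integrable P (\<lambda>y. ((y - m) / s) ^ k)"
  defines "E \<equiv> \<lambda>k. (LINT y|P. ((y - m) / s) ^ k)" and "\<mu> \<equiv> (LINT y|P. y)"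
  shows "\<mu> = m + s * E 1" "(LINT y|P. (y - \<mu>)\<^sup>2) = s\<^sup>2 * E 2 - (m - \<mu>)\<^sup>2"
proof -
  interpret prob_space P by fact
  have i: "integrable P (\<lambda>y. (y - m) / s)" "integrable P (\<lambda>y. ((y - m) / s)\<^sup>2)"
    using assms(3)[of 1] assms(3)[of 2] by simp_all
  have "\<mu> = (LINT y|P. m + s * ((y - m) / s))"
    unfolding \<mu>_def using assms(2) by simp
  also have "\<dots> = m + s * E 1"
    unfolding E_def using i
    by (subst Bochner_Integration.integral_add) (simp_all add: prob_space del: times_divide_eq_right)
  finally show \<mu>: "\<mu> = m + s * E 1" .
  have "(LINT y|P. (y - \<mu>)\<^sup>2) =
      (LINT y|P. (m - \<mu>)\<^sup>2 + 2 * (m - \<mu>) * s * ((y - m) / s) + s\<^sup>2 * ((y - m) / s)\<^sup>2)"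
    using assms(2)
    by (intro Bochner_Integration.integral_cong) (simp_all add: power2_eq_square field_simps)
  also have "\<dots> = (m - \<mu>)\<^sup>2 + 2 * (m - \<mu>) * (s * E 1) + s\<^sup>2 * E 2"
    unfolding E_def using i
    by (simp add: prob_space del: times_divide_eq_right)
  also have "s * E 1 = - (m - \<mu>)" using \<mu> by simp
  finally show "(LINT y|P. (y - \<mu>)\<^sup>2) = s\<^sup>2 * E 2 - (m - \<mu>)\<^sup>2"
    by (simp add: power2_eq_square algebra_simps)
qed

lemma J_mean_variance:
  fixes t0 t1 x0 x1 \<eta> \<rho> t :: real
  assumes t: "t0 < t1" "\<eta> > 0" "\<rho> > 0" "t \<in> {t0..t1}" "t \<noteq> (t0 + t1) / 2"
  defines "m \<equiv> bridge_mean t0 t1 x0 x1 t" and "\<tau> \<equiv> bridge_var t0 t1 \<eta> \<rho> t"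
    and "a \<equiv> a_coeff t0 t1 x0 x1 \<eta> \<rho> t" and "\<mu> \<equiv> J_mean t0 t1 x0 x1 \<eta> \<rho> t"
  defines "M \<equiv> gauss_moment (support_set t0 t1 t a)"
  shows "\<mu> = m + sqrt \<tau> * ((M 3 + 2 * a * M 2 - M 1) / (M 2 + 2 * a * M 1 - M 0))"
    and "(J_sd t0 t1 x0 x1 \<eta> \<rho> t)\<^sup>2 =
      \<tau> * ((M 4 + 2 * a * M 3 - M 2) / (M 2 + 2 * a * M 1 - M 0)) - (m - \<mu>)\<^sup>2"
proof -
  let ?P = "J_law t0 t1 x0 x1 \<eta> \<rho> t"
  have \<tau>: "\<tau> > 0" using bridge_var_pos t unfolding \<tau>_def by blast
  note P = prob_space_J_law[OF t(1-4)]
  have int: "integrable ?P (\<lambda>y. ((y - m) / sqrt \<tau>) ^ k)" for k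
  proof -
    have "integrable ?P (\<lambda>y. (\<Sum>i\<le>k. of_nat (k choose i) * (- m) ^ (k - i) * y ^ i) / sqrt \<tau> ^ k)"
      using integrable_J_law[OF t(1,3,4)]
      by (intro integrable_divide Bochner_Integration.integrable_sum integrable_mult_right)
    moreover have "((y - m) / sqrt \<tau>) ^ k =
        (\<Sum>i\<le>k. of_nat (k choose i) * (- m) ^ (k - i) * y ^ i) / sqrt \<tau> ^ k" for y
      using binomial_ring[of y "- m" k] by (simp add: power_divide mult_ac)
    ultimately show ?thesis by simp
  qed
  note E = J_law_standardised_moment[OF t, of x0 x1, folded m_def \<tau>_def a_def]
  have q: "quad_moment (support_set t0 t1 t a) a 0 = M 2 + 2 * a * M 1 - M 0"
    "quad_moment (support_set t0 t1 t a) a 1 = M 3 + 2 * a * M 2 - M 1"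
    "quad_moment (support_set t0 t1 t a) a 2 = M 4 + 2 * a * M 3 - M 2"
    by (simp_all add: quad_moment_def M_def numeral_eq_Suc)
  have sq: "sqrt \<tau> \<noteq> 0" using \<tau> by simp
  note mv = mean_variance_of_standardised_moments[OF P sq int, unfolded E q, folded J_mean_def \<mu>_def]
  show "\<mu> = m + sqrt \<tau> * ((M 3 + 2 * a * M 2 - M 1) / (M 2 + 2 * a * M 1 - M 0))"
    by (rule mv(1))
  show "(J_sd t0 t1 x0 x1 \<eta> \<rho> t)\<^sup>2 =
      \<tau> * ((M 4 + 2 * a * M 3 - M 2) / (M 2 + 2 * a * M 1 - M 0)) - (m - \<mu>)\<^sup>2"
    unfolding J_sd_squared[OF t(1-4)] \<mu>_def[symmetric] mv(2) using \<tau> by simp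
qed

lemma J_mean_sd_midpoint:
  shows "J_mean t0 t1 x x \<eta> \<rho> ((t0 + t1) / 2) = 0"
    and "J_sd t0 t1 x x \<eta> \<rho> ((t0 + t1) / 2) = 1"
proof -
  have law: "J_law t0 t1 x x \<eta> \<rho> ((t0 + t1) / 2) = density lborel (\<lambda>y. ennreal (std_normal_density y))"
    by (simp add: J_law_def J_density_def)
  have mom: "(LINT y|density lborel (\<lambda>y. ennreal (std_normal_density y)). y ^ k) =
      (LINT y|lborel. std_normal_density y * y ^ k)" for k
    by (subst integral_density) auto
  show mean: "J_mean t0 t1 x x \<eta> \<rho> ((t0 + t1) / 2) = 0"
    unfolding J_mean_def law using mom[of 1] integral_std_normal_moment_odd[of 0] by simp
  show "J_sd t0 t1 x x \<eta> \<rho> ((t0 + t1) / 2) = 1"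
    unfolding J_sd_def J_mean_def[symmetric] mean unfolding law
    using mom[of 2] integral_std_normal_moment_even[of 1] by simp
qed

theorem theoremA1:
  fixes t0 t1 x0 x1 \<eta> \<rho> t :: real
  assumes "t0 < t1" and "\<eta> > 0" and "\<rho> > 0"
  shows
    "let m = bridge_mean t0 t1 x0 x1 t;
         \<tau> = bridge_var t0 t1 \<eta> \<rho> t;
         a = a_coeff t0 t1 x0 x1 \<eta> \<rho> t;
         \<mu>J = J_mean t0 t1 x0 x1 \<eta> \<rho> t;
         \<sigma>J = J_sd t0 t1 x0 x1 \<eta> \<rho> t;
         I = I_seq a;
         I' = I_tilde a
     in
       (t \<in> {(t0 + t1) / 2 <.. t1} \<longrightarrow>
          \<mu>J = m + sqrt \<tau> * ((I 3 + 2 * a * I 2 - I 1) / (I 2 + 2 * a * I 1 - I 0)) \<and>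
          \<sigma>J\<^sup>2 = \<tau> * ((I 4 + 2 * a * I 3 - I 2) / (I 2 + 2 * a * I 1 - I 0)) - (m - \<mu>J)\<^sup>2) \<and>
       (t \<in> {t0 ..< (t0 + t1) / 2} \<longrightarrow>
          \<mu>J = m + sqrt \<tau> * ((I' 3 + 2 * a * I' 2 - I' 1) / (I' 2 + 2 * a * I' 1 - I' 0)) \<and>
          \<sigma>J\<^sup>2 = \<tau> * ((I' 4 + 2 * a * I' 3 - I' 2) / (I' 2 + 2 * a * I' 1 - I' 0)) - (m - \<mu>J)\<^sup>2) \<and>
       (t = (t0 + t1) / 2 \<and> x0 = x1 \<longrightarrow> \<mu>J = 0 \<and> \<sigma>J = 1)"
proof -
  define a where "a = a_coeff t0 t1 x0 x1 \<eta> \<rho> t"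
  note J = J_mean_variance[OF assms, of t x0 x1, folded a_def]
  have late: "gauss_moment (support_set t0 t1 t a) = I_seq a" if "t > (t0 + t1) / 2"
    using that by (simp add: fun_eq_iff support_set_def gauss_moment_between_roots)
  have early: "gauss_moment (support_set t0 t1 t a) = I_tilde a" if "t < (t0 + t1) / 2"
    using that by (simp add: fun_eq_iff support_set_def gauss_moment_outside_roots)
  show ?thesis
    unfolding Let_def a_def[symmetric]
  proof (intro conjI impI; (elim conjE)?)
    assume "t \<in> {(t0 + t1) / 2 <.. t1}"
    then have t: "t \<in> {t0..t1}" "t \<noteq> (t0 + t1) / 2" "t > (t0 + t1) / 2" using assms(1) by auto
    note J = J[OF t(1,2), unfolded late[OF t(3)]]
    show "J_mean t0 t1 x0 x1 \<eta> \<rho> t = bridge_mean t0 t1 x0 x1 t + sqrt (bridge_var t0 t1 \<eta> \<rho> t) *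
        ((I_seq a 3 + 2 * a * I_seq a 2 - I_seq a 1) / (I_seq a 2 + 2 * a * I_seq a 1 - I_seq a 0))"
      by (rule J(1))
    show "(J_sd t0 t1 x0 x1 \<eta> \<rho> t)\<^sup>2 = bridge_var t0 t1 \<eta> \<rho> t *
        ((I_seq a 4 + 2 * a * I_seq a 3 - I_seq a 2) / (I_seq a 2 + 2 * a * I_seq a 1 - I_seq a 0))
        - (bridge_mean t0 t1 x0 x1 t - J_mean t0 t1 x0 x1 \<eta> \<rho> t)\<^sup>2"
      by (rule J(2))
  next
    assume "t \<in> {t0 ..< (t0 + t1) / 2}"
    then have t: "t \<in> {t0..t1}" "t \<noteq> (t0 + t1) / 2" "t < (t0 + t1) / 2" using assms(1) by auto
    note J = J[OF t(1,2), unfolded early[OF t(3)]]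
    show "J_mean t0 t1 x0 x1 \<eta> \<rho> t = bridge_mean t0 t1 x0 x1 t + sqrt (bridge_var t0 t1 \<eta> \<rho> t) *
        ((I_tilde a 3 + 2 * a * I_tilde a 2 - I_tilde a 1) / (I_tilde a 2 + 2 * a * I_tilde a 1 - I_tilde a 0))"
      by (rule J(1))
    show "(J_sd t0 t1 x0 x1 \<eta> \<rho> t)\<^sup>2 = bridge_var t0 t1 \<eta> \<rho> t *
        ((I_tilde a 4 + 2 * a * I_tilde a 3 - I_tilde a 2) / (I_tilde a 2 + 2 * a * I_tilde a 1 - I_tilde a 0))
        - (bridge_mean t0 t1 x0 x1 t - J_mean t0 t1 x0 x1 \<eta> \<rho> t)\<^sup>2"
      by (rule J(2))
  qed (simp_all only: J_mean_sd_midpoint)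
qed

end
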